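(* For $x\in V$ let $\widetilde\theta(x)=\big\langle\sum_{l=\sigma}^{\tau_B}\mathbf 1_x(x_l)\big\rangle$ be the average number of times the reactive trajectories visit $x$. Then $\widetilde\theta(x)=\mu_r(x)$ for $x\in A$, and $$\widetilde\theta(x)=\sum_{y\in V^+}\widetilde\theta(y)\,\widetilde p(x\,|\,y),\qquad\forall x\in A^c .$$ In particular, $\sum_{x\in B}\widetilde\theta(x)=1$.
   Context: $V=\{1,\dots,n\}$ with $n>1$; $p(y\,|\,x)$, $x,y\in V$, is the probability that a discrete-time Markov chain $(x_k)_{k\ge0}$ on $V$ jumps from $x$ to $y$ (so $\sum_{y}p(y\,|\,x)=1$). $A,B\subset V$ are disjoint and nonempty, complements are taken in $V$, and $\mu$ is a probability distribution on $A$. For $x\in V$, a set $A$ (resp. $B$) is reachable from $x$ if there is a finite path $x_0=x,x_1,\dots,x_k$, $k\ge0$, with $x_k\in A$ (resp. $x_k\in B$), $x_l\in(A\cup B)^c$ for $1\le l\le k-1$, and $p(x_{l+1}\,|\,x_l)>0$ for $0\le l\le k-1$. Standing assumption: $(A\cup B)^c\ne\emptyset$; from each $x\in(A\cup B)^c$ either $A$ or $B$ is reachable; and $B$ is reachable from each $x\in A$. $\tau_A=\min\{k\ge0:x_k\in A\}$, $\tau_B=\min\{k\ge 0:x_k\in B\}$ ($+\infty$ if never reached), with subscript $x$ when $x_0=x$. Committor: $q(x)=\mathbb P(\tau_{B,x}<\tau_{A,x})$, $x\in V$. For $x_0\in A$, the last hitting time of $A$ is $\sigma=\max\{l: x_l\in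 A,\ 0\le l<\tau_B\}$; the reactive trajectory is $(x_\sigma,\dots,x_{\tau_B})$. $\langle\cdot\rangle$ denotes expectation over first passage paths $(x_0,\dots,x_{\tau_B})$ of the chain with $x_0\sim\mu$. $\mu_r(x)=\langle\mathbf 1_x(x_\sigma)\rangle$ for $x\in A$. $V^+=\{x\in B^c:\sum_{z\in V}p(z\,|\,x)q(z)>0\}$. For $y\in V^+$: $\widetilde p(x\,|\,y)=\frac{p(x\,|\,y)q(x)}{q(y)}$ if $y\notin A$, and $\widetilde p(x\,|\,y)=\frac{p(x\,|\,y)q(x)}{\sum_{z\in V}p(z\,|\,y)q(z)}$ if $y\in A$. (These are transition probabilities on $V^+\cup B$; for $x\notin V^+\cup B$ the same formula is used, and it gives $0$.) *)

theory Defs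
  imports "HOL-Probability.Probability" "HOL-Library.Extended_Nat"
begin

text \<open>
  \<open>pmf (p x) y\<close> is the probability \<open>p(y | x)\<close> of jumping from \<open>x\<close> to \<open>y\<close>; \<open>\<nu>\<close> is the law of the
  initial state.
\<close>

definition markov_chain ::
  "nat set \<Rightarrow> (nat \<Rightarrow> nat pmf) \<Rightarrow> nat pmf \<Rightarrow> 'w measure \<Rightarrow> (nat \<Rightarrow> 'w \<Rightarrow> nat) \<Rightarrow> bool" where
  "markov_chain V p \<nu> M X \<longleftrightarrow>
     prob_space M \<and>
     (\<forall>k. X k \<in> measurable M (count_space V)) \<and>
     (\<forall>x. \<P>(\<omega> in M. X 0 \<omega> = x) = pmf \<nu> x) \<and>
     (\<forall>k x y. \<P>(\<omega> in M. \<forall>i\<le>k. X i \<omega> = x i) > 0 \<longrightarrow>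
        \<P>(\<omega> in M. X (Suc k) \<omega> = y \<bar> \<forall>i\<le>k. X i \<omega> = x i) = pmf (p (x k)) y)"

definition reachable ::
  "nat set \<Rightarrow> (nat \<Rightarrow> nat pmf) \<Rightarrow> nat set \<Rightarrow> nat set \<Rightarrow> nat set \<Rightarrow> nat \<Rightarrow> bool" where
  "reachable V p A B S x \<longleftrightarrow>
     (\<exists>k xs. xs 0 = x \<and> (\<forall>l\<le>k. xs l \<in> V) \<and> xs k \<in> S \<and>
        (\<forall>l. 1 \<le> l \<and> l < k \<longrightarrow> xs l \<in> V - (A \<union> B)) \<and>
        (\<forall>l<k. pmf (p (xs l)) (xs (Suc l)) > 0))"

text \<open>The infimum of the empty set in \<^typ>\<open>enat\<close> is \<open>\<infinity>\<close>.\<close>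

definition hitting_time :: "nat set \<Rightarrow> (nat \<Rightarrow> nat) \<Rightarrow> enat" where
  "hitting_time S x = Inf (enat ` {k. x k \<in> S})"

text \<open>
  \<open>Max\<close> is meaningful when \<open>x 0 \<in> A\<close>, \<open>A\<close> and \<open>B\<close> are disjoint, and \<open>x\<close> reaches \<open>B\<close>; the same
  proviso applies to the finite sum in \<open>reactive_visits\<close>.
\<close>

definition last_hitting_time :: "nat set \<Rightarrow> nat set \<Rightarrow> (nat \<Rightarrow> nat) \<Rightarrow> nat" where
  "last_hitting_time A B x = Max {l. x l \<in> A \<and> enat l < hitting_time B x}"

definition committor ::
  "nat set \<Rightarrow> nat set \<Rightarrow> (nat \<Rightarrow> 'w measure) \<Rightarrow> (nat \<Rightarrow> 'w \<Rightarrow> nat) \<Rightarrow> nat \<Rightarrow> real" where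
  "committor A B Q Y x =
     \<P>(\<omega> in Q x. hitting_time B (\<lambda>k. Y k \<omega>) < hitting_time A (\<lambda>k. Y k \<omega>))"

definition reactive_entrance ::
  "nat set \<Rightarrow> nat set \<Rightarrow> 'w measure \<Rightarrow> (nat \<Rightarrow> 'w \<Rightarrow> nat) \<Rightarrow> nat \<Rightarrow> real" where
  "reactive_entrance A B M X x =
     (\<integral>\<omega>. indicator {x} (X (last_hitting_time A B (\<lambda>k. X k \<omega>)) \<omega>) \<partial>M)"

definition reactive_visits ::
  "nat set \<Rightarrow> nat set \<Rightarrow> 'w measure \<Rightarrow> (nat \<Rightarrow> 'w \<Rightarrow> nat) \<Rightarrow> nat \<Rightarrow> real" where
  "reactive_visits A B M X x =
     (\<integral>\<omega>. (\<Sum>l | last_hitting_time A B (\<lambda>k. X k \<omega>) \<le> l \<and>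
                  enat l \<le> hitting_time B (\<lambda>k. X k \<omega>). indicator {x} (X l \<omega>)) \<partial>M)"

definition reactive_states ::
  "nat set \<Rightarrow> (nat \<Rightarrow> nat pmf) \<Rightarrow> nat set \<Rightarrow> (nat \<Rightarrow> real) \<Rightarrow> nat set" where
  "reactive_states V p B q = {x \<in> V - B. (\<Sum>z\<in>V. pmf (p x) z * q z) > 0}"

text \<open>
  \<open>reactive_kernel V p A q y x\<close> is the probability of a jump of the reactive trajectory from \<open>y\<close> to \<open>x\<close>.
\<close>

definition reactive_kernel ::
  "nat set \<Rightarrow> (nat \<Rightarrow> nat pmf) \<Rightarrow> nat set \<Rightarrow> (nat \<Rightarrow> real) \<Rightarrow> nat \<Rightarrow> nat \<Rightarrow> real" where
  "reactive_kernel V p A q y x =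
     (if y \<notin> A then pmf (p y) x * q x / q y
      else pmf (p y) x * q x / (\<Sum>z\<in>V. pmf (p y) z * q z))"

end

theory Submission
  imports Defs
begin

text \<open>
  Let \<open>G(x)\<close> be the expected number of visits to \<open>x\<close> up to \<open>\<tau>\<^sub>B\<close>. A visit to \<open>x\<close> at time \<open>l \<le> \<tau>\<^sub>B\<close> is
  part of the reactive trajectory iff the chain started at \<open>x\<^sub>l\<close> (at \<open>x\<^sub>l\<^sub>+\<^sub>1\<close> if \<open>x \<in> A\<close>) hits \<open>B\<close> before
  \<open>A\<close>. By the Markov property \<open>\<theta>(x) = G(x) q(x)\<close> for \<open>x \<notin> A\<close> and
  \<open>\<theta>(x) = G(x) \<Sum>\<^sub>z p(z | x) q(z)\<close> for \<open>x \<in> A\<close>. Conditioning on the previous state gives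
  \<open>G(x) = \<Sum>\<^sub>y G(y) p(x | y)\<close> over \<open>y \<notin> B\<close>, for \<open>x \<notin> A\<close>; multiplying by \<open>q(x)\<close> and using that \<open>q\<close> is
  harmonic off \<open>A \<union> B\<close> yields the equation for \<open>\<theta>\<close>. All series converge because \<open>B\<close> is hit within
  a fixed number of steps with probability bounded away from zero, so the tail of \<open>\<tau>\<^sub>B\<close> is geometric.
\<close>

section \<open>Paths\<close>

text \<open>A finite-horizon version of the event that \<open>B\<close> is hit before
  \<open>A\<close>. It involves only the coordinates up to \<open>k\<close>, obeys a one-step
  recursion, and increases with \<open>k\<close> to the full event.\<close>

definition reaches_within :: "nat set \<Rightarrow> nat set \<Rightarrow> nat \<Rightarrow> (nat \<Rightarrow> nat) \<Rightarrow> bool" where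
  "reaches_within A B k w \<longleftrightarrow> (\<exists>j\<le>k. w j \<in> B \<and> (\<forall>i\<le>j. w i \<notin> A))"

lemma reaches_within_0: "reaches_within A B 0 w \<longleftrightarrow> w 0 \<in> B \<and> w 0 \<notin> A"
  by (auto simp: reaches_within_def)

lemma reaches_within_Suc:
  "reaches_within A B (Suc k) w \<longleftrightarrow>
     w 0 \<notin> A \<and> (w 0 \<in> B \<or> reaches_within A B k (\<lambda>i. w (Suc i)))"
proof
  assume "reaches_within A B (Suc k) w"
  then obtain j where j: "j \<le> Suc k" "w j \<in> B" "\<And>i. i \<le> j \<Longrightarrow> w i \<notin> A"
    by (auto simp: reaches_within_def)
  then show "w 0 \<notin> A \<and> (w 0 \<in> B \<or> reaches_within A B k (\<lambda>i. w (Suc i)))"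
    by (cases j) (auto simp: reaches_within_def)
next
  assume r: "w 0 \<notin> A \<and> (w 0 \<in> B \<or> reaches_within A B k (\<lambda>i. w (Suc i)))"
  show "reaches_within A B (Suc k) w"
  proof (cases "w 0 \<in> B")
    case True
    then show ?thesis using r by (auto simp: reaches_within_def)
  next
    case False
    then obtain j where "j \<le> k" "w (Suc j) \<in> B" "\<And>i. i \<le> j \<Longrightarrow> w (Suc i) \<notin> A"
      using r by (auto simp: reaches_within_def)
    moreover have "w i \<notin> A" if "i \<le> Suc j" for i
      using that r calculation(3) by (cases i) auto
    ultimately show ?thesis by (auto simp: reaches_within_def intro!: exI[of _ "Suc j"])
  qed
qed

lemma reaches_within_mono: "k \<le> k' \<Longrightarrow> reaches_within A B k w \<Longrightarrow> reaches_within A B k' w"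
  unfolding reaches_within_def using le_trans by blast

lemma ex_reaches_within:
  "(\<exists>k. reaches_within A B k w) \<longleftrightarrow> (\<exists>j. w j \<in> B \<and> (\<forall>i\<le>j. w i \<notin> A))"
  by (auto simp: reaches_within_def)

section \<open>Comparisons with hitting times as conditions on the path\<close>

lemma enat_less_hitting_time: "enat l < hitting_time S w \<longleftrightarrow> (\<forall>k\<le>l. w k \<notin> S)"
proof
  assume "enat l < hitting_time S w"
  then have "enat l < enat k" if "w k \<in> S" for k
  proof -
    have "hitting_time S w \<le> enat k" unfolding hitting_time_def using that by (intro Inf_lower) simp
    with \<open>enat l < hitting_time S w\<close> show ?thesis by (rule less_le_trans)
  qed
  then show "\<forall>k\<le>l. w k \<notin> S" by (force simp: not_less)
next
  assume none: "\<forall>k\<le>l. w k \<notin> S"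
  have "enat (Suc l) \<le> hitting_time S w"
    unfolding hitting_time_def
  proof (rule Inf_greatest)
    fix t assume "t \<in> enat ` {k. w k \<in> S}"
    then obtain k where k: "t = enat k" "w k \<in> S" by auto
    then have "\<not> k \<le> l" using none by blast
    then show "enat (Suc l) \<le> t" using k(1) by simp
  qed
  then show "enat l < hitting_time S w"
    by (rule less_le_trans[rotated]) simp
qed

lemma enat_le_hitting_time: "enat l \<le> hitting_time S w \<longleftrightarrow> (\<forall>k<l. w k \<notin> S)"
proof (cases l)
  case 0
  then show ?thesis by (simp add: zero_enat_def[symmetric])
next
  case (Suc m)
  then have "enat l \<le> hitting_time S w \<longleftrightarrow> enat m < hitting_time S w"
    by (metis Suc_ile_eq)
  then show ?thesis using Suc by (simp add: enat_less_hitting_time less_Suc_eq_le)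
qed

text \<open>Strictness forces \<open>B\<close> to be hit at a finite time, so the committor event is
  the increasing union over \<open>k\<close> of the events
  \<open>reaches_within A B k\<close>.\<close>

lemma hitting_time_less_iff:
  "hitting_time B w < hitting_time A w \<longleftrightarrow> (\<exists>j. w j \<in> B \<and> (\<forall>i\<le>j. w i \<notin> A))"
proof
  assume lt: "hitting_time B w < hitting_time A w"
  then obtain l where l: "hitting_time B w = enat l" by (cases "hitting_time B w") auto
  then have "\<not> (\<forall>k\<le>l. w k \<notin> B)"
    using enat_less_hitting_time[of l B w] by simp
  moreover have "\<forall>k\<le>l. w k \<notin> A" using lt l enat_less_hitting_time[of l A w] by simp
  ultimately show "\<exists>j. w j \<in> B \<and> (\<forall>i\<le>j. w i \<notin> A)" by auto
next
  assume "\<exists>j. w j \<in> B \<and> (\<forall>i\<le>j. w i \<notin> A)"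
  then obtain j where j: "w j \<in> B" "\<forall>i\<le>j. w i \<notin> A" by auto
  then have "hitting_time B w \<le> enat j"
    using enat_less_hitting_time[of j B w] by (auto simp: not_less[symmetric])
  also have "enat j < hitting_time A w" using j by (simp add: enat_less_hitting_time)
  finally show "hitting_time B w < hitting_time A w" .
qed

text \<open>Since \<open>last_hitting_time\<close> looks into the future, the condition is recast as
  one on the past before \<open>l\<close> and one on the future. At a state of \<open>A\<close> the
  future starts at \<open>Suc l\<close>, because the visit at \<open>l\<close> itself would violate
  the avoidance of \<open>A\<close>.\<close>

definition reactive_time :: "nat set \<Rightarrow> nat set \<Rightarrow> (nat \<Rightarrow> nat) \<Rightarrow> nat \<Rightarrow> bool" where
  "reactive_time A B w l \<longleftrightarrow> (\<forall>i<l. w i \<notin> B) \<and>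
     (\<exists>k. reaches_within A B k (\<lambda>i. w ((if w l \<in> A then Suc l else l) + i)))"

text \<open>If \<open>B\<close> is never hit, the window is an upper ray and the sum over it takes
  its default value 0; the sum is a genuine count exactly on the paths that hit
  \<open>B\<close>.\<close>

lemma reactive_window_finite_iff:
  "finite {l. last_hitting_time A B w \<le> l \<and> enat l \<le> hitting_time B w} \<longleftrightarrow> (\<exists>k. w k \<in> B)"
proof
  assume "\<exists>k. w k \<in> B"
  then obtain k where k: "w k \<in> B" by auto
  have "l \<le> k" if "\<forall>i<l. w i \<notin> B" for l
    using k that by (metis not_le)
  then have "{l. last_hitting_time A B w \<le> l \<and> enat l \<le> hitting_time B w} \<subseteq> {..k}"
    unfolding enat_le_hitting_time by blast
  then show "finite {l. last_hitting_time A B w \<le> l \<and> enat l \<le> hitting_time B w}"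
    by (rule finite_subset) simp
next
  assume fin: "finite {l. last_hitting_time A B w \<le> l \<and> enat l \<le> hitting_time B w}"
  show "\<exists>k. w k \<in> B"
  proof (rule ccontr)
    assume "\<nexists>k. w k \<in> B"
    then have "{l. last_hitting_time A B w \<le> l \<and> enat l \<le> hitting_time B w}
        = {last_hitting_time A B w..}"
      unfolding enat_le_hitting_time by auto
    then show False using fin infinite_Ici by metis
  qed
qed

section \<open>Paths that start in \<open>A\<close> and hit \<open>B\<close>\<close>

context
  fixes A B :: "nat set" and w :: "nat \<Rightarrow> nat"
  assumes disjoint: "A \<inter> B = {}" and start: "w 0 \<in> A" and hits: "\<exists>k. w k \<in> B"
begin

text \<open>\<open>Max\<close> is meaningful here: a hit of \<open>B\<close> bounds the set, and
  time 0 belongs to it because \<open>A\<close> and \<open>B\<close> are disjoint.\<close>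

lemma last_hitting_time_props:
  defines "\<sigma> \<equiv> last_hitting_time A B w"
  shows "w \<sigma> \<in> A" "\<forall>k\<le>\<sigma>. w k \<notin> B"
    and "\<And>l. w l \<in> A \<Longrightarrow> \<forall>k\<le>l. w k \<notin> B \<Longrightarrow> l \<le> \<sigma>"
proof -
  let ?S = "{l. w l \<in> A \<and> enat l < hitting_time B w}"
  obtain k where k: "w k \<in> B" using hits by auto
  have "?S \<subseteq> {..k}" using k by (auto simp: enat_less_hitting_time) (meson nat_le_linear)
  then have fin: "finite ?S" by (rule finite_subset) simp
  have "0 \<in> ?S" using start disjoint by (auto simp: enat_less_hitting_time)
  then have "\<sigma> \<in> ?S" unfolding \<sigma>_def last_hitting_time_def using fin by (intro Max_in) auto
  then show "w \<sigma> \<in> A" "\<forall>k\<le>\<sigma>. w k \<notin> B" by (auto simp: enat_less_hitting_time)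
  show "l \<le> \<sigma>" if "w l \<in> A" "\<forall>k\<le>l. w k \<notin> B" for l
    unfolding \<sigma>_def last_hitting_time_def using that fin
    by (intro Max_ge) (auto simp: enat_less_hitting_time)
qed

text \<open>After \<sigma> the path meets \<open>B\<close> before it meets \<open>A\<close> again;
  watched from any earlier time, it still has the visit at \<sigma> ahead of it.\<close>

lemma reactive_time_iff:
  "reactive_time A B w l \<longleftrightarrow> last_hitting_time A B w \<le> l \<and> enat l \<le> hitting_time B w"
proof -
  define \<sigma> where "\<sigma> = last_hitting_time A B w"
  note \<sigma> = last_hitting_time_props[folded \<sigma>_def]
  define T where "T = (LEAST k. w k \<in> B)"
  have T: "w T \<in> B" "\<And>k. k < T \<Longrightarrow> w k \<notin> B"
    unfolding T_def using hits LeastI_ex[of "\<lambda>k. w k \<in> B"] not_less_Least by blast+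
  have \<sigma>T: "\<sigma> < T" using \<sigma>(2) T(1) by (meson not_le)
  define s where "s = (if w l \<in> A then Suc l else l)"
  have le_T: "(\<forall>i<l. w i \<notin> B) \<longleftrightarrow> l \<le> T" using T by (meson not_le order.strict_trans2)
  have "(\<exists>j. w (s + j) \<in> B \<and> (\<forall>i\<le>j. w (s + i) \<notin> A)) \<longleftrightarrow> \<sigma> \<le> l" if lT: "l \<le> T"
  proof
    assume "\<sigma> \<le> l"
    \<comment> \<open>If \<open>w l\<close> is in \<open>A\<close>, then \<open>l\<close> differs
      from \<open>T\<close>, where the path is in \<open>B\<close>; so even the shifted start is at
      most \<open>T\<close>.\<close>
    have "s \<le> T" using lT T(1) disjoint by (auto simp: s_def Suc_le_eq le_less)
    have "w (s + i) \<notin> A" if "i \<le> T - s" for i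
    proof
      assume a: "w (s + i) \<in> A"
      then have "s + i < T" using that \<open>s \<le> T\<close> T(1) disjoint
        by (cases "s + i = T") auto
      then have "s + i \<le> \<sigma>" using \<sigma>(3)[OF a] T(2) by simp
      \<comment> \<open>\<open>s + i \<le> l\<close> forces \<open>i = 0\<close> and
        \<open>s = l\<close>, yet \<open>s = l\<close> holds only if \<open>w l\<close> is outside
        \<open>A\<close>.\<close>
      then show False using \<open>\<sigma> \<le> l\<close> a by (cases i) (auto simp: s_def split: if_splits)
    qed
    then show "\<exists>j. w (s + j) \<in> B \<and> (\<forall>i\<le>j. w (s + i) \<notin> A)"
      using T(1) \<open>s \<le> T\<close> by (intro exI[of _ "T - s"]) auto
  next
    assume "\<exists>j. w (s + j) \<in> B \<and> (\<forall>i\<le>j. w (s + i) \<notin> A)"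
    then obtain j where j: "w (s + j) \<in> B" "\<And>i. i \<le> j \<Longrightarrow> w (s + i) \<notin> A" by auto
    have "T \<le> s + j" using j(1) T(2) by (meson not_le)
    show "\<sigma> \<le> l"
    proof (rule ccontr)
      assume "\<not> \<sigma> \<le> l"
      then have "s \<le> \<sigma>" by (simp add: s_def)
      \<comment> \<open>Seen from \<open>s\<close>, the visit at \<sigma> falls inside the stretch
        up to \<open>j\<close> that must avoid \<open>A\<close>.\<close>
      moreover have "\<sigma> - s \<le> j" using \<sigma>T \<open>T \<le> s + j\<close> by linarith
      ultimately show False using j(2)[of "\<sigma> - s"] \<sigma>(1) by simp
    qed
  qed
  then show ?thesis
    unfolding reactive_time_def ex_reaches_within enat_le_hitting_time
      s_def[symmetric] \<sigma>_def[symmetric]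
    using le_T by blast
qed

text \<open>Inside the window \<open>A\<close> is visited only at \<sigma>: a later visit before the
  hit of \<open>B\<close> would contradict maximality, and the state at the hit lies in
  \<open>B\<close>.\<close>

lemma sum_reactive_window_entrance:
  assumes "x \<in> A"
  shows "(\<Sum>l | last_hitting_time A B w \<le> l \<and> enat l \<le> hitting_time B w. indicator {x} (w l) :: real)
    = indicator {x} (w (last_hitting_time A B w))" (is "sum _ ?S = _")
proof -
  define \<sigma> where "\<sigma> = last_hitting_time A B w"
  note \<sigma> = last_hitting_time_props[folded \<sigma>_def]
  have "\<sigma> \<in> ?S" using \<sigma>(2) by (auto simp: \<sigma>_def enat_le_hitting_time)
  have "w l \<noteq> x" if "l \<in> ?S" "l \<noteq> \<sigma>" for l
  proof
    assume "w l = x"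
    have "\<forall>k<l. w k \<notin> B" using that(1) by (simp add: enat_le_hitting_time)
    then have "\<forall>k\<le>l. w k \<notin> B" using \<open>w l = x\<close> assms disjoint by (auto simp: le_less)
    then have "l \<le> \<sigma>" using \<sigma>(3)[of l] \<open>w l = x\<close> assms by simp
    then show False using that by (auto simp: \<sigma>_def)
  qed
  then have "(\<Sum>l\<in>?S. indicator {x} (w l) :: real) = (\<Sum>l\<in>{\<sigma>}. indicator {x} (w l))"
    using reactive_window_finite_iff hits \<open>\<sigma> \<in> ?S\<close> by (intro sum.mono_neutral_right) auto
  then show ?thesis by (simp add: \<sigma>_def)
qed

end

section \<open>Hitting probabilities\<close>

text \<open>With \<open>A = {}\<close> this is the distribution function of \<open>\<tau>\<^sub>B\<close>.\<close>

primrec hit_prob ::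
  "nat set \<Rightarrow> (nat \<Rightarrow> nat pmf) \<Rightarrow> nat set \<Rightarrow> nat set \<Rightarrow> nat \<Rightarrow> nat \<Rightarrow> real" where
  "hit_prob V p A B 0 x = (if x \<in> B - A then 1 else 0)"
| "hit_prob V p A B (Suc k) x =
     (if x \<in> A then 0 else if x \<in> B then 1
      else \<Sum>y\<in>V. pmf (p x) y * hit_prob V p A B k y)"

lemma hit_prob_nonneg: "0 \<le> hit_prob V p A B k x"
  by (induction k arbitrary: x) (auto intro!: sum_nonneg)

lemma hit_prob_Suc_mono: "hit_prob V p A B k x \<le> hit_prob V p A B (Suc k) x"
proof (induction k arbitrary: x)
  case 0
  then show ?case by (auto intro!: sum_nonneg)
next
  case (Suc k)
  then have "(\<Sum>y\<in>V. pmf (p x) y * hit_prob V p A B k y)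
      \<le> (\<Sum>y\<in>V. pmf (p x) y * hit_prob V p A B (Suc k) y)"
    by (intro sum_mono mult_left_mono) auto
  then show ?case by (simp only: hit_prob.simps(2) split: if_split) simp
qed

lemma hit_prob_mono: "k \<le> k' \<Longrightarrow> hit_prob V p A B k x \<le> hit_prob V p A B k' x"
  using lift_Suc_mono_le[of "\<lambda>k. hit_prob V p A B k x"] hit_prob_Suc_mono by metis

text \<open>Keeping only the summand of the path's next state bounds each step of the recursion
  below by a positive product; where the path is already in \<open>B\<close>, the value is
  1.\<close>

lemma hit_prob_pos_path:
  assumes "finite V" "\<forall>l\<le>k. xs l \<in> V" "\<forall>l<k. pmf (p (xs l)) (xs (Suc l)) > 0"
    and "hit_prob V p {} B j (xs k) > 0"
  shows "hit_prob V p {} B (k + j) (xs 0) > 0"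
  using assms
proof (induction k arbitrary: xs)
  case 0
  then show ?case by simp
next
  case (Suc k)
  have "hit_prob V p {} B (k + j) (xs 1) > 0"
    using Suc.IH[of "\<lambda>i. xs (Suc i)"] Suc.prems by auto
  then have "0 < pmf (p (xs 0)) (xs 1) * hit_prob V p {} B (k + j) (xs 1)"
    using Suc.prems(3) by auto
  also have "\<dots> \<le> (\<Sum>y\<in>V. pmf (p (xs 0)) y * hit_prob V p {} B (k + j) y)"
    using Suc.prems by (intro member_le_sum) (auto simp: hit_prob_nonneg)
  finally show ?case by simp
qed

text \<open>The target \<open>S\<close> is general so that reachability can be chained: a state that
  reaches \<open>A\<close> inherits positivity from the states of \<open>A\<close>.\<close>

lemma reachable_hit_prob_pos:
  assumes "finite V" "reachable V p A B S x" "\<And>y. y \<in> S \<Longrightarrow> \<exists>j. hit_prob V p {} B j y > 0"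
  shows "\<exists>k. hit_prob V p {} B k x > 0"
proof -
  obtain k xs where xs: "xs 0 = x" "\<forall>l\<le>k. xs l \<in> V" "xs k \<in> S"
    "\<forall>l<k. pmf (p (xs l)) (xs (Suc l)) > 0"
    using assms(2) by (auto simp: reachable_def)
  obtain j where "hit_prob V p {} B j (xs k) > 0" using assms(3) xs(3) by auto
  from hit_prob_pos_path[where xs=xs and p=p, OF assms(1) xs(2,4) this] show ?thesis using xs(1) by auto
qed

section \<open>The Markov property\<close>

text \<open>The initial law is left general, so that the same results serve the chain started from
  \<mu> and the chains started at a point that define the committor.\<close>

locale finite_markov_chain = prob_space M for M :: "'w measure" +
  fixes V :: "nat set" and p :: "nat \<Rightarrow> nat pmf" and \<nu> :: "nat pmf"
    and X :: "nat \<Rightarrow> 'w \<Rightarrow> nat"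
  assumes chain: "markov_chain V p \<nu> M X" and finite_V: "finite V"
begin

lemma X_in_V: "\<omega> \<in> space M \<Longrightarrow> X k \<omega> \<in> V"
  using chain measurable_space[of "X k" M "count_space V" \<omega>] by (auto simp: markov_chain_def)

lemma X_measurable [measurable]: "X k \<in> measurable M (count_space UNIV)"
proof -
  have "X k \<in> measurable M (count_space V)" using chain by (auto simp: markov_chain_def)
  from measurable_compose[OF this, of "\<lambda>x. x" "count_space UNIV"] show ?thesis by simp
qed

lemma prob_X_0: "prob {\<omega> \<in> space M. X 0 \<omega> = x} = pmf \<nu> x"
  using chain by (auto simp: markov_chain_def)

lemma prob_path_step:
  assumes "prob {\<omega> \<in> space M. \<forall>i\<le>l. X i \<omega> = s i} > 0"
  shows "prob {\<omega> \<in> space M. X (Suc l) \<omega> = y \<and> (\<forall>i\<le>l. X i \<omega> = s i)}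
    = prob {\<omega> \<in> space M. \<forall>i\<le>l. X i \<omega> = s i} * pmf (p (s l)) y"
proof -
  have "cond_prob M (\<lambda>\<omega>. X (Suc l) \<omega> = y) (\<lambda>\<omega>. \<forall>i\<le>l. X i \<omega> = s i) = pmf (p (s l)) y"
    using chain[unfolded markov_chain_def, THEN conjunct2, THEN conjunct2, THEN conjunct2,
      rule_format, OF assms] .
  then show ?thesis using assms unfolding cond_prob_def by (simp add: nonzero_divide_eq_eq mult.commute)
qed

lemma prob_finite_partition:
  assumes "finite I" "\<And>\<omega>. \<omega> \<in> space M \<Longrightarrow> f \<omega> \<in> I"
    and "\<And>i. Measurable.pred M (\<lambda>\<omega>. f \<omega> = i)" "Measurable.pred M P"
  shows "prob {\<omega> \<in> space M. P \<omega>} = (\<Sum>i\<in>I. prob {\<omega> \<in> space M. P \<omega> \<and> f \<omega> = i})"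
proof -
  note assms(3,4)[measurable]
  have "{\<omega> \<in> space M. P \<omega>} = (\<Union>i\<in>I. {\<omega> \<in> space M. P \<omega> \<and> f \<omega> = i})"
    using assms(2) by auto
  also have "prob \<dots> = (\<Sum>i\<in>I. prob {\<omega> \<in> space M. P \<omega> \<and> f \<omega> = i})"
    using assms(1) by (intro finite_measure_finite_Union) (auto simp: disjoint_family_on_def)
  finally show ?thesis .
qed

text \<open>A pointwise substitute for membership in the sigma-algebra generated by
  \<open>X 0, ..., X l\<close>; it suits a partition by finite histories.\<close>

definition determined :: "nat \<Rightarrow> ('w \<Rightarrow> bool) \<Rightarrow> bool" where
  "determined l H \<longleftrightarrow> (\<forall>\<omega> \<omega>'. (\<forall>i\<le>l. X i \<omega> = X i \<omega>') \<longrightarrow> H \<omega> = H \<omega>')"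

text \<open>The defining property of the chain conditions on one full history. As \<open>V\<close>
  is finite there are finitely many histories up to \<open>l\<close>, and \<open>H\<close> is
  constant on each, so summing over them extends the property to every past event.\<close>

lemma prob_step:
  assumes H: "determined l H" and [measurable]: "Measurable.pred M H"
  shows "prob {\<omega> \<in> space M. H \<omega> \<and> X l \<omega> = x \<and> X (Suc l) \<omega> = y}
    = prob {\<omega> \<in> space M. H \<omega> \<and> X l \<omega> = x} * pmf (p x) y"
proof -
  \<comment> \<open>Histories are made extensional so that they range over the finite set
    \<open>I\<close>.\<close>
  define R where "R \<omega> = restrict (\<lambda>i. X i \<omega>) {..l}" for \<omega>
  define I where "I = PiE {..l} (\<lambda>_. V)"
  have fin: "finite I" unfolding I_def by (intro finite_PiE) (auto simp: finite_V)
  have R_in: "R \<omega> \<in> I" if "\<omega> \<in> space M" for \<omega>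
    using that X_in_V by (auto simp: R_def I_def)
  have R_eq: "R \<omega> = s \<longleftrightarrow> s \<in> extensional {..l} \<and> (\<forall>i\<le>l. X i \<omega> = s i)" for \<omega> s
    by (auto simp: R_def fun_eq_iff extensional_def restrict_def)
  have R_meas[measurable]: "Measurable.pred M (\<lambda>\<omega>. R \<omega> = s)" for s
    unfolding R_eq by measurable
  have step: "prob {\<omega> \<in> space M. (H \<omega> \<and> X l \<omega> = x \<and> X (Suc l) \<omega> = y) \<and> R \<omega> = s}
    = prob {\<omega> \<in> space M. (H \<omega> \<and> X l \<omega> = x) \<and> R \<omega> = s} * pmf (p x) y" for s
  proof (cases "\<exists>\<omega>\<in>space M. H \<omega> \<and> X l \<omega> = x \<and> R \<omega> = s")
    case False
    then have "{\<omega> \<in> space M. (H \<omega> \<and> X l \<omega> = x \<and> X (Suc l) \<omega> = y) \<and> R \<omega> = s} = {}"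
      "{\<omega> \<in> space M. (H \<omega> \<and> X l \<omega> = x) \<and> R \<omega> = s} = {}" by blast+
    then show ?thesis by (simp only: measure_empty)
  next
    case True
    then obtain \<omega>0 where \<omega>0: "H \<omega>0" "X l \<omega>0 = x" "R \<omega>0 = s" by auto
    have s: "s \<in> extensional {..l}" "s l = x" using \<omega>0 R_eq[of \<omega>0 s] by auto
    have H': "H \<omega> \<and> X l \<omega> = x" if "\<forall>i\<le>l. X i \<omega> = s i" for \<omega>
      using H \<omega>0 R_eq[of \<omega>0 s] that s unfolding determined_def by (metis order_refl)
    have 1: "{\<omega> \<in> space M. (H \<omega> \<and> X l \<omega> = x \<and> X (Suc l) \<omega> = y) \<and> R \<omega> = s}
        = {\<omega> \<in> space M. X (Suc l) \<omega> = y \<and> (\<forall>i\<le>l. X i \<omega> = s i)}"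
      using H' s by (auto simp: R_eq)
    have 2: "{\<omega> \<in> space M. (H \<omega> \<and> X l \<omega> = x) \<and> R \<omega> = s}
        = {\<omega> \<in> space M. \<forall>i\<le>l. X i \<omega> = s i}"
      using H' s by (auto simp: R_eq)
    show ?thesis
    proof (cases "prob {\<omega> \<in> space M. \<forall>i\<le>l. X i \<omega> = s i} > 0")
      case True
      show ?thesis unfolding 1 2 by (rule prob_path_step[OF True, of y, unfolded s(2)])
    next
      \<comment> \<open>A history of probability zero admits no conditioning; both sides vanish
        there.\<close>
      case False
      then have 0: "prob {\<omega> \<in> space M. \<forall>i\<le>l. X i \<omega> = s i} = 0"
        unfolding zero_less_measure_iff by blast
      have "prob {\<omega> \<in> space M. X (Suc l) \<omega> = y \<and> (\<forall>i\<le>l. X i \<omega> = s i)}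
          \<le> prob {\<omega> \<in> space M. \<forall>i\<le>l. X i \<omega> = s i}"
        by (intro finite_measure_mono) (blast, measurable)
      then have "prob {\<omega> \<in> space M. X (Suc l) \<omega> = y \<and> (\<forall>i\<le>l. X i \<omega> = s i)} = 0"
        unfolding 0 by (rule order_antisym) (rule measure_nonneg)
      then show ?thesis unfolding 1 2 0 by (simp only: mult_zero_left)
    qed
  qed
  have lhs: "Measurable.pred M (\<lambda>\<omega>. H \<omega> \<and> X l \<omega> = x \<and> X (Suc l) \<omega> = y)"
    and rhs: "Measurable.pred M (\<lambda>\<omega>. H \<omega> \<and> X l \<omega> = x)"
    by measurable
  have "prob {\<omega> \<in> space M. H \<omega> \<and> X l \<omega> = x \<and> X (Suc l) \<omega> = y}
      = (\<Sum>s\<in>I. prob {\<omega> \<in> space M. (H \<omega> \<and> X l \<omega> = x \<and> X (Suc l) \<omega> = y) \<and> R \<omega> = s})"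
    using fin R_in R_meas lhs by (rule prob_finite_partition)
  also have "\<dots> = (\<Sum>s\<in>I. prob {\<omega> \<in> space M. (H \<omega> \<and> X l \<omega> = x) \<and> R \<omega> = s}) * pmf (p x) y"
    by (simp only: step sum_distrib_right)
  also have "(\<Sum>s\<in>I. prob {\<omega> \<in> space M. (H \<omega> \<and> X l \<omega> = x) \<and> R \<omega> = s})
      = prob {\<omega> \<in> space M. H \<omega> \<and> X l \<omega> = x}"
    using fin R_in R_meas rhs by (rule prob_finite_partition[symmetric])
  finally show ?thesis .
qed

lemma determined_mono: "determined l H \<Longrightarrow> l \<le> m \<Longrightarrow> determined m H"
  unfolding determined_def using le_trans by blast

lemma determined_state: "determined l H \<Longrightarrow> determined l (\<lambda>\<omega>. H \<omega> \<and> X l \<omega> = x)"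
  unfolding determined_def
proof (intro allI impI)
  fix \<omega> \<omega>'
  assume H: "\<forall>\<omega> \<omega>'. (\<forall>i\<le>l. X i \<omega> = X i \<omega>') \<longrightarrow> H \<omega> = H \<omega>'"
    and eq: "\<forall>i\<le>l. X i \<omega> = X i \<omega>'"
  from eq have "X l \<omega> = X l \<omega>'" by blast
  moreover from H eq have "H \<omega> = H \<omega>'" by blast
  ultimately show "(H \<omega> \<and> X l \<omega> = x) = (H \<omega>' \<and> X l \<omega>' = x)" by (simp only:)
qed

section \<open>Hitting events counted from a given time\<close>

lemma reaches_within_measurable [measurable]:
  "Measurable.pred M (\<lambda>\<omega>. reaches_within A B k (\<lambda>i. X (l + i) \<omega>))"
  unfolding reaches_within_def by measurable

text \<open>Induction on the horizon with \<open>l\<close>, \<open>H\<close> and \<open>x\<close>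
  all general: the step moves the present to \<open>Suc l\<close> and absorbs \<open>X l = x\<close>
  into the past event.\<close>

lemma prob_reaches_within:
  assumes "determined l H" "Measurable.pred M H"
  shows "prob {\<omega> \<in> space M. (H \<omega> \<and> X l \<omega> = x) \<and> reaches_within A B k (\<lambda>i. X (l + i) \<omega>)}
    = prob {\<omega> \<in> space M. H \<omega> \<and> X l \<omega> = x} * hit_prob V p A B k x"
  using assms
proof (induction k arbitrary: l H x)
  case 0
  have "{\<omega> \<in> space M. (H \<omega> \<and> X l \<omega> = x) \<and> reaches_within A B 0 (\<lambda>i. X (l + i) \<omega>)}
    = (if x \<in> B - A then {\<omega> \<in> space M. H \<omega> \<and> X l \<omega> = x} else {})"
    by (auto simp: reaches_within_0)
  then show ?case by simp
next
  case (Suc k)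
  note Suc.prems(2)[measurable]
  let ?H = "\<lambda>\<omega>. H \<omega> \<and> X l \<omega> = x"
  consider "x \<in> A" | "x \<notin> A" "x \<in> B" | "x \<notin> A" "x \<notin> B" by auto
  then show ?case
  proof cases
    case 1
    then have eq: "{\<omega> \<in> space M. ?H \<omega> \<and> reaches_within A B (Suc k) (\<lambda>i. X (l + i) \<omega>)} = {}"
      by (auto simp: reaches_within_Suc)
    show ?thesis unfolding eq using 1 by simp
  next
    case 2
    then have eq: "{\<omega> \<in> space M. ?H \<omega> \<and> reaches_within A B (Suc k) (\<lambda>i. X (l + i) \<omega>)}
        = {\<omega> \<in> space M. ?H \<omega>}"
      by (auto simp: reaches_within_Suc)
    show ?thesis unfolding eq using 2 by simp
  next
    case 3
    then have eq: "{\<omega> \<in> space M. ?H \<omega> \<and> reaches_within A B (Suc k) (\<lambda>i. X (l + i) \<omega>)}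
        = {\<omega> \<in> space M. ?H \<omega> \<and> reaches_within A B k (\<lambda>i. X (Suc l + i) \<omega>)}"
      by (auto simp: reaches_within_Suc)
    have det: "determined (Suc l) ?H"
      using Suc.prems(1) by (intro determined_mono[OF determined_state]) auto
    have "prob {\<omega> \<in> space M. ?H \<omega> \<and> reaches_within A B k (\<lambda>i. X (Suc l + i) \<omega>)}
      = (\<Sum>y\<in>V. prob {\<omega> \<in> space M. (?H \<omega> \<and> reaches_within A B k (\<lambda>i. X (Suc l + i) \<omega>))
          \<and> X (Suc l) \<omega> = y})"
      by (intro prob_finite_partition[where f="X (Suc l)"] finite_V X_in_V) measurable
    also have "\<dots> = (\<Sum>y\<in>V. prob {\<omega> \<in> space M. (?H \<omega> \<and> X (Suc l) \<omega> = y)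
          \<and> reaches_within A B k (\<lambda>i. X (Suc l + i) \<omega>)})"
      by (intro sum.cong refl arg_cong[where f=prob]) auto
    also have "\<dots> = (\<Sum>y\<in>V. prob {\<omega> \<in> space M. ?H \<omega> \<and> X (Suc l) \<omega> = y} * hit_prob V p A B k y)"
      by (intro sum.cong refl Suc.IH det) measurable
    also have "\<dots> = (\<Sum>y\<in>V. prob {\<omega> \<in> space M. ?H \<omega>} * pmf (p x) y * hit_prob V p A B k y)"
      using prob_step[OF Suc.prems] by (simp add: conj_assoc)
    finally show ?thesis unfolding eq using 3 by (simp add: sum_distrib_left mult.assoc)
  qed
qed

text \<open>Continuity from below in the horizon. Stating a limit instead of a value allows its use
  to identify the limit of \<open>hit_prob\<close> itself as the committor.\<close>

lemma prob_reaches_eventually_LIMSEQ: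
  assumes "determined l H" "Measurable.pred M H"
  shows "(\<lambda>k. prob {\<omega> \<in> space M. H \<omega> \<and> X l \<omega> = x} * hit_prob V p A B k x) \<longlonglongrightarrow>
    prob {\<omega> \<in> space M. (H \<omega> \<and> X l \<omega> = x) \<and> (\<exists>k. reaches_within A B k (\<lambda>i. X (l + i) \<omega>))}"
proof -
  note assms(2)[measurable]
  let ?E = "\<lambda>k. {\<omega> \<in> space M. (H \<omega> \<and> X l \<omega> = x) \<and> reaches_within A B k (\<lambda>i. X (l + i) \<omega>)}"
  have "incseq ?E"
    by (rule incseq_SucI) (use reaches_within_mono[OF le_SucI[OF order_refl]] in blast)
  then have lim: "(\<lambda>k. prob (?E k)) \<longlonglongrightarrow> prob (\<Union>k. ?E k)"
    by (rule finite_Lim_measure_incseq[rotated]) (intro image_subsetI, measurable)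
  have E: "(\<lambda>k. prob (?E k)) = (\<lambda>k. prob {\<omega> \<in> space M. H \<omega> \<and> X l \<omega> = x} * hit_prob V p A B k x)"
    by (rule ext) (rule prob_reaches_within[OF assms])
  have UN: "(\<Union>k. ?E k) = {\<omega> \<in> space M. (H \<omega> \<and> X l \<omega> = x) \<and> (\<exists>k. reaches_within A B k (\<lambda>i. X (l + i) \<omega>))}"
    by blast
  show ?thesis by (rule lim[unfolded E UN])
qed

lemma prob_reaches_eventually:
  assumes "determined l H" "Measurable.pred M H" "(\<lambda>k. hit_prob V p A B k x) \<longlonglongrightarrow> L"
  shows "prob {\<omega> \<in> space M. (H \<omega> \<and> X l \<omega> = x) \<and> (\<exists>k. reaches_within A B k (\<lambda>i. X (l + i) \<omega>))}
    = prob {\<omega> \<in> space M. H \<omega> \<and> X l \<omega> = x} * L"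
  by (rule LIMSEQ_unique[OF prob_reaches_eventually_LIMSEQ[OF assms(1,2)]
        tendsto_mult_left[OF assms(3)]])

end

section \<open>The committor as a limit of hitting probabilities\<close>

lemma finite_markov_chainI:
  assumes "finite V" "markov_chain V p \<nu> M X"
  shows "finite_markov_chain M V p \<nu> X"
  using assms unfolding finite_markov_chain_def finite_markov_chain_axioms_def markov_chain_def
  by blast

text \<open>The committor is defined through the measures \<open>Q x\<close>; expressing it by the
  kernel \<open>p\<close> makes it usable for the chain under \<open>M\<close>.\<close>

lemma hit_prob_LIMSEQ_committor:
  assumes "finite V" "markov_chain V p (return_pmf x) (Q x) Y"
  shows "(\<lambda>k. hit_prob V p A B k x) \<longlonglongrightarrow> committor A B Q Y x"
proof -
  interpret finite_markov_chain "Q x" V p "return_pmf x" Y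
    using assms by (rule finite_markov_chainI)
  have start: "AE \<omega> in Q x. Y 0 \<omega> = x"
  proof -
    have "AE \<omega> in Q x. \<omega> \<in> {\<omega> \<in> space (Q x). Y 0 \<omega> = x}"
      by (rule AE_prob_1) (simp only: prob_X_0 pmf_return indicator_simps singletonI)
    then show ?thesis by eventually_elim blast
  qed
  let ?E = "\<lambda>\<omega>. \<exists>k. reaches_within A B k (\<lambda>i. Y (0 + i) \<omega>)"
  have "prob {\<omega> \<in> space (Q x). (True \<and> Y 0 \<omega> = x) \<and> ?E \<omega>} = prob {\<omega> \<in> space (Q x). ?E \<omega>}"
  proof (rule finite_measure_eq_AE)
    show "AE \<omega> in Q x. (\<omega> \<in> {\<omega> \<in> space (Q x). (True \<and> Y 0 \<omega> = x) \<and> ?E \<omega>})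
        = (\<omega> \<in> {\<omega> \<in> space (Q x). ?E \<omega>})"
      using start by eventually_elim blast
  qed measurable
  also have "\<dots> = committor A B Q Y x"
    unfolding committor_def hitting_time_less_iff ex_reaches_within add_0 ..
  finally have E: "prob {\<omega> \<in> space (Q x). (True \<and> Y 0 \<omega> = x) \<and> ?E \<omega>} = committor A B Q Y x" .
  have 1: "prob {\<omega> \<in> space (Q x). True \<and> Y 0 \<omega> = x} = 1"
    using prob_X_0[of x] unfolding simp_thms pmf_return by simp
  have "determined 0 (\<lambda>_. True)" by (simp add: determined_def)
  moreover have "Measurable.pred (Q x) (\<lambda>_. True)" by measurable
  ultimately show ?thesis
    using prob_reaches_eventually_LIMSEQ[of 0 "\<lambda>_. True" x A B] unfolding E 1 mult_1 by blast
qed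

section \<open>Transition paths\<close>

text \<open>A partial sum \<open>S\<close> is at most the first \<open>N\<close> terms plus the
  shifted sum, hence at most these terms plus \<open>(1 - c) * S\<close>; solving for
  \<open>S\<close> gives a uniform bound.\<close>

lemma summable_shift_contraction:
  fixes f :: "nat \<Rightarrow> real"
  assumes nonneg: "\<And>l. 0 \<le> f l" and "c > 0" and contr: "\<And>l. f (l + N) \<le> (1 - c) * f l"
  shows "summable f"
proof (rule summableI_nonneg_bounded)
  fix L
  have "(\<Sum>l<L. f l) \<le> (\<Sum>l<L + N. f l)"
    by (rule sum_mono2) (auto simp: nonneg)
  also have "\<dots> = (\<Sum>l<N. f l) + (\<Sum>l<L. f (l + N))"
    by (induction L) auto
  also have "(\<Sum>l<L. f (l + N)) \<le> (\<Sum>l<L. (1 - c) * f l)"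
    by (rule sum_mono) (rule contr)
  also have "\<dots> = (1 - c) * (\<Sum>l<L. f l)" by (rule sum_distrib_left[symmetric])
  finally have "c * (\<Sum>l<L. f l) \<le> (\<Sum>l<N. f l)" by (simp add: algebra_simps)
  then show "(\<Sum>l<L. f l) \<le> (\<Sum>l<N. f l) / c" using \<open>c > 0\<close> by (simp add: field_simps)
qed (rule nonneg)

text \<open>Reachability is taken in the form of a positive chance to hit \<open>B\<close> from
  every state, and \<open>q\<close> as the limit of \<open>hit_prob\<close>.\<close>

locale transition_path = finite_markov_chain M V p \<nu> X
  for M :: "'w measure" and V p \<nu> X +
  fixes A B :: "nat set" and q :: "nat \<Rightarrow> real"
  assumes B_subset: "B \<subseteq> V" and disjoint: "A \<inter> B = {}"
    and hit_pos: "x \<in> V \<Longrightarrow> \<exists>k. hit_prob V p {} B k x > 0"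
    and start_in_A: "set_pmf \<nu> \<subseteq> A"
    and q_LIMSEQ: "x \<in> V \<Longrightarrow> (\<lambda>k. hit_prob V p A B k x) \<longlonglongrightarrow> q x"
begin

text \<open>The probability of hitting \<open>B\<close> before \<open>A\<close> counted from time 1
  on, for a start at \<open>y\<close>; on \<open>A\<close> it is the normalising constant of
  \<open>reactive_kernel\<close>.\<close>

definition escape :: "nat \<Rightarrow> real" where
  "escape y = (\<Sum>z\<in>V. pmf (p y) z * q z)"

section \<open>Boundary values and harmonicity of \<open>q\<close>\<close>

lemma q_nonneg: "x \<in> V \<Longrightarrow> 0 \<le> q x"
  using q_LIMSEQ by (rule LIMSEQ_le_const) (auto simp: hit_prob_nonneg)

lemma q_B: "x \<in> B \<Longrightarrow> q x = 1"
proof -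
  assume x: "x \<in> B"
  then have "x \<notin> A" "x \<in> V" using disjoint B_subset by auto
  have "hit_prob V p A B k x = 1" for k using x \<open>x \<notin> A\<close> by (cases k) auto
  then have "(\<lambda>k. 1) \<longlonglongrightarrow> q x" using q_LIMSEQ[OF \<open>x \<in> V\<close>] by simp
  then show ?thesis by (simp add: LIMSEQ_const_iff)
qed

lemma escape_nonneg: "0 \<le> escape y"
  unfolding escape_def by (auto intro!: sum_nonneg simp: q_nonneg)

text \<open>Off both sets the recursion of \<open>hit_prob\<close> passes to the limit in the
  horizon.\<close>

lemma q_harmonic:
  assumes "y \<in> V" "y \<notin> A" "y \<notin> B"
  shows "q y = escape y"
proof (rule LIMSEQ_unique)
  show "(\<lambda>k. hit_prob V p A B (Suc k) y) \<longlonglongrightarrow> q y"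
    using q_LIMSEQ[OF assms(1)] by (rule LIMSEQ_Suc)
  show "(\<lambda>k. hit_prob V p A B (Suc k) y) \<longlonglongrightarrow> escape y"
    using assms(2,3) unfolding escape_def hit_prob.simps if_False
    by (auto intro!: tendsto_intros q_LIMSEQ)
qed

text \<open>The tail of the hitting time of \<open>B\<close>. The strict \<open>i<l\<close> admits a
  first hit at \<open>l\<close> itself, so that \<open>occupation\<close> also records the entrance
  into \<open>B\<close>.\<close>

definition survival :: "nat \<Rightarrow> real" where
  "survival l = prob {\<omega> \<in> space M. \<forall>i<l. X i \<omega> \<notin> B}"

definition occupation :: "nat \<Rightarrow> nat \<Rightarrow> real" where
  "occupation x l = prob {\<omega> \<in> space M. (\<forall>i<l. X i \<omega> \<notin> B) \<and> X l \<omega> = x}"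

text \<open>The Green function of the chain stopped after its first visit to
  \<open>B\<close>.\<close>

definition green :: "nat \<Rightarrow> real" where
  "green x = (\<Sum>l. occupation x l)"

lemma determined_survival: "l \<le> Suc m \<Longrightarrow> determined m (\<lambda>\<omega>. \<forall>i<l. X i \<omega> \<notin> B)"
  unfolding determined_def
proof (intro allI impI)
  fix \<omega> \<omega>'
  assume "l \<le> Suc m" and eq: "\<forall>i\<le>m. X i \<omega> = X i \<omega>'"
  then have "X i \<omega> = X i \<omega>'" if "i < l" for i using that by simp
  then show "(\<forall>i<l. X i \<omega> \<notin> B) = (\<forall>i<l. X i \<omega>' \<notin> B)" by (simp cong: all_cong)
qed

section \<open>Decay of the survival probability\<close>

lemma survival_eq_sum: "survival l = (\<Sum>x\<in>V. occupation x l)"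
  unfolding survival_def occupation_def
  by (rule prob_finite_partition) (auto simp: finite_V X_in_V)

lemma occupation_nonneg: "0 \<le> occupation x l"
  by (simp add: occupation_def)

lemma occupation_le_survival: "occupation x l \<le> survival l"
  unfolding occupation_def survival_def
  by (intro finite_measure_mono) (blast, measurable)

lemma survival_Suc: "survival (Suc l) = (\<Sum>x\<in>V - B. occupation x l)"
proof -
  have "survival (Suc l) = (\<Sum>x\<in>V. prob {\<omega> \<in> space M. (\<forall>i<Suc l. X i \<omega> \<notin> B) \<and> X l \<omega> = x})"
    unfolding survival_def by (rule prob_finite_partition) (auto simp: finite_V X_in_V)
  also have "\<dots> = (\<Sum>x\<in>V. if x \<in> B then 0 else occupation x l)"
  proof (rule sum.cong[OF refl])
    fix x assume "x \<in> V"
    have "{\<omega> \<in> space M. (\<forall>i<Suc l. X i \<omega> \<notin> B) \<and> X l \<omega> = x}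
        = (if x \<in> B then {} else {\<omega> \<in> space M. (\<forall>i<l. X i \<omega> \<notin> B) \<and> X l \<omega> = x})"
      by (auto simp: less_Suc_eq)
    then show "prob {\<omega> \<in> space M. (\<forall>i<Suc l. X i \<omega> \<notin> B) \<and> X l \<omega> = x}
        = (if x \<in> B then 0 else occupation x l)"
      by (simp add: occupation_def)
  qed
  also have "\<dots> = (\<Sum>x\<in>V - B. occupation x l)"
    using finite_V by (intro sum.mono_neutral_cong_right) auto
  finally show ?thesis .
qed

text \<open>Survival is lost by a hit of \<open>B\<close> at one of the \<open>N + 1\<close> times
  from \<open>l\<close> to \<open>l + N\<close>, whence \<open>Suc N\<close>; the Markov property
  gives the probability of that hit.\<close>

lemma survival_add:
  "survival (l + Suc N) = survival l - (\<Sum>x\<in>V. occupation x l * hit_prob V p {} B N x)"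
proof -
  let ?H = "\<lambda>\<omega>. \<forall>i<l. X i \<omega> \<notin> B"
  let ?R = "\<lambda>\<omega>. reaches_within {} B N (\<lambda>i. X (l + i) \<omega>)"
  have "{\<omega> \<in> space M. \<forall>i<l + Suc N. X i \<omega> \<notin> B} = {\<omega> \<in> space M. ?H \<omega>} - {\<omega> \<in> space M. ?H \<omega> \<and> ?R \<omega>}"
    (is "?L = ?T")
  proof -
    have "(\<forall>i<l + Suc N. X i \<omega> \<notin> B) \<longleftrightarrow> ?H \<omega> \<and> \<not> ?R \<omega>" for \<omega>
    proof
      assume "\<forall>i<l + Suc N. X i \<omega> \<notin> B"
      then show "?H \<omega> \<and> \<not> ?R \<omega>" by (auto simp: reaches_within_def)
    next
      assume a: "?H \<omega> \<and> \<not> ?R \<omega>"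
      show "\<forall>i<l + Suc N. X i \<omega> \<notin> B"
      proof (intro allI impI)
        fix i assume "i < l + Suc N"
        then show "X i \<omega> \<notin> B"
          using a by (cases "i < l") (auto simp: reaches_within_def dest!: spec[of _ "i - l"])
      qed
    qed
    then show ?thesis by blast
  qed
  then have "survival (l + Suc N) = survival l - prob {\<omega> \<in> space M. ?H \<omega> \<and> ?R \<omega>}"
    unfolding survival_def by (simp only:) (rule finite_measure_Diff, measurable, blast)
  also have "prob {\<omega> \<in> space M. ?H \<omega> \<and> ?R \<omega>}
      = (\<Sum>x\<in>V. prob {\<omega> \<in> space M. (?H \<omega> \<and> ?R \<omega>) \<and> X l \<omega> = x})"
    by (intro prob_finite_partition[where f="X l"] finite_V X_in_V) measurable
  also have "\<dots> = (\<Sum>x\<in>V. prob {\<omega> \<in> space M. (?H \<omega> \<and> X l \<omega> = x) \<and> ?R \<omega>})"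
    by (simp only: conj_ac)
  also have "\<dots> = (\<Sum>x\<in>V. occupation x l * hit_prob V p {} B N x)"
    unfolding occupation_def
    by (intro sum.cong refl prob_reaches_within determined_survival) (simp, measurable)
  finally show ?thesis .
qed

text \<open>Monotonicity in the horizon replaces the state-dependent horizons by a common one, and
  finiteness of \<open>V\<close> gives a positive minimum.\<close>

lemma uniform_hit_prob:
  obtains c N where "c > 0" "\<And>x. x \<in> V \<Longrightarrow> c \<le> hit_prob V p {} B N x"
proof -
  from hit_pos obtain k where k: "\<And>x. x \<in> V \<Longrightarrow> hit_prob V p {} B (k x) x > 0" by metis
  \<comment> \<open>The sum dominates each \<open>k x\<close>.\<close>
  define N where "N = (\<Sum>x\<in>V. k x)"
  have pos: "hit_prob V p {} B N x > 0" if "x \<in> V" for x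
  proof -
    have "k x \<le> N" unfolding N_def using that finite_V by (intro member_le_sum) auto
    then show ?thesis using k[OF that] hit_prob_mono less_le_trans by metis
  qed
  \<comment> \<open>The inserted 1 keeps \<open>Min\<close> on a nonempty set.\<close>
  define c where "c = Min (insert 1 (hit_prob V p {} B N ` V))"
  have "c > 0" unfolding c_def using finite_V pos by (subst Min_gr_iff) auto
  moreover have "c \<le> hit_prob V p {} B N x" if "x \<in> V" for x
    unfolding c_def using that finite_V by (intro Min_le) auto
  ultimately show ?thesis by (rule that)
qed

text \<open>Every block of \<open>Suc N\<close> steps shrinks survival at least by the factor
  \<open>1 - c\<close>.\<close>

lemma summable_survival: "summable survival"
proof -
  obtain c N where c: "c > 0" "\<And>x. x \<in> V \<Longrightarrow> c \<le> hit_prob V p {} B N x"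
    by (rule uniform_hit_prob) blast
  show ?thesis
  proof (rule summable_shift_contraction[OF _ c(1)])
    show "0 \<le> survival l" for l by (simp add: survival_def)
    show "survival (l + Suc N) \<le> (1 - c) * survival l" for l
    proof -
      have "c * survival l \<le> (\<Sum>x\<in>V. occupation x l * hit_prob V p {} B N x)"
        unfolding survival_eq_sum sum_distrib_left mult.commute[of c]
        by (intro sum_mono mult_left_mono c(2) occupation_nonneg)
      then show ?thesis by (simp add: survival_add algebra_simps del: add_Suc_right)
    qed
  qed
qed

lemma summable_occupation: "summable (occupation x)"
  using summable_survival
  by (rule summable_comparison_test_ev[rotated])
     (simp add: occupation_nonneg occupation_le_survival)

text \<open>Never hitting \<open>B\<close> is at most as likely as surviving to any
  \<open>l\<close>, and the survival probabilities tend to 0 as terms of a convergent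
  series.\<close>

lemma AE_hits_B: "AE \<omega> in M. \<exists>k. X k \<omega> \<in> B"
proof -
  have "prob {\<omega> \<in> space M. \<forall>k. X k \<omega> \<notin> B} \<le> survival l" for l
    unfolding survival_def by (intro finite_measure_mono) (blast, measurable)
  then have "prob {\<omega> \<in> space M. \<forall>k. X k \<omega> \<notin> B} \<le> 0"
    using summable_LIMSEQ_zero[OF summable_survival] LIMSEQ_le_const by blast
  then have "prob {\<omega> \<in> space M. \<forall>k. X k \<omega> \<notin> B} = 0"
    using measure_nonneg order_antisym by blast
  then have "AE \<omega> in M. \<omega> \<notin> {\<omega> \<in> space M. \<forall>k. X k \<omega> \<notin> B}"
    by (subst (asm) prob_eq_0) measurable
  then show ?thesis using AE_space by eventually_elim blast
qed

lemma AE_start: "AE \<omega> in M. X 0 \<omega> \<in> A"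
proof -
  have "AE \<omega> in M. X 0 \<omega> \<noteq> x" if "x \<in> V - A" for x
  proof -
    have "prob {\<omega> \<in> space M. X 0 \<omega> = x} = 0"
      using start_in_A that by (auto simp: prob_X_0 set_pmf_iff)
    then have "AE \<omega> in M. \<omega> \<notin> {\<omega> \<in> space M. X 0 \<omega> = x}"
      by (subst (asm) prob_eq_0) measurable
    then show ?thesis using AE_space by eventually_elim blast
  qed
  then have "AE \<omega> in M. \<forall>x\<in>V - A. X 0 \<omega> \<noteq> x"
    using finite_V by (intro AE_finite_allI) auto
  then show ?thesis using AE_space by eventually_elim (use X_in_V in blast)
qed

lemma green_equation:
  assumes "x \<in> V - A"
  shows "green x = (\<Sum>y\<in>V - B. green y * pmf (p y) x)"
proof -
  \<comment> \<open>The start in \<open>A\<close> removes the term at time 0, so the shifted series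
    is all of \<open>green x\<close>.\<close>
  have "occupation x 0 = 0"
    using assms start_in_A by (auto simp: occupation_def prob_X_0 set_pmf_iff)
  have "occupation x (Suc l) = (\<Sum>y\<in>V - B. occupation y l * pmf (p y) x)" for l
  proof -
    have "occupation x (Suc l)
      = (\<Sum>y\<in>V. prob {\<omega> \<in> space M. ((\<forall>i<Suc l. X i \<omega> \<notin> B) \<and> X (Suc l) \<omega> = x) \<and> X l \<omega> = y})"
      unfolding occupation_def
      by (intro prob_finite_partition[where f="X l"] finite_V X_in_V) measurable
    \<comment> \<open>A state of \<open>B\<close> at time \<open>l\<close> rules out survival to
      \<open>Suc l\<close>.\<close>
    also have "\<dots> = (\<Sum>y\<in>V. if y \<in> B then 0 else occupation y l * pmf (p y) x)"
    proof (rule sum.cong[OF refl])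
      fix y assume "y \<in> V"
      have eq: "{\<omega> \<in> space M. ((\<forall>i<Suc l. X i \<omega> \<notin> B) \<and> X (Suc l) \<omega> = x) \<and> X l \<omega> = y}
        = (if y \<in> B then {}
           else {\<omega> \<in> space M. (\<forall>i<l. X i \<omega> \<notin> B) \<and> X l \<omega> = y \<and> X (Suc l) \<omega> = x})"
        by (auto simp: less_Suc_eq)
      have "prob {\<omega> \<in> space M. (\<forall>i<l. X i \<omega> \<notin> B) \<and> X l \<omega> = y \<and> X (Suc l) \<omega> = x}
        = occupation y l * pmf (p y) x"
        unfolding occupation_def by (rule prob_step[OF determined_survival]) (simp, measurable)
      then show "prob {\<omega> \<in> space M. ((\<forall>i<Suc l. X i \<omega> \<notin> B) \<and> X (Suc l) \<omega> = x) \<and> X l \<omega> = y}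
        = (if y \<in> B then 0 else occupation y l * pmf (p y) x)"
        unfolding eq by simp
    qed
    also have "\<dots> = (\<Sum>y\<in>V - B. occupation y l * pmf (p y) x)"
      using finite_V by (intro sum.mono_neutral_cong_right) auto
    finally show ?thesis .
  qed
  then have "(\<Sum>l. occupation x (Suc l)) = (\<Sum>l. \<Sum>y\<in>V - B. occupation y l * pmf (p y) x)"
    by simp
  also have "\<dots> = (\<Sum>y\<in>V - B. \<Sum>l. occupation y l * pmf (p y) x)"
    by (intro suminf_sum summable_mult2 summable_occupation)
  also have "\<dots> = (\<Sum>y\<in>V - B. green y * pmf (p y) x)"
    unfolding green_def by (simp add: suminf_mult2[OF summable_occupation])
  finally show ?thesis
    using suminf_split_head[OF summable_occupation[of x]] \<open>occupation x 0 = 0\<close>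
    by (simp add: green_def)
qed

text \<open>The mass that first enters \<open>B\<close> at time \<open>l\<close> is the drop of
  survival from \<open>l\<close> to \<open>Suc l\<close>; these drops telescope from 1 down to
  0.\<close>

lemma sum_green_B: "(\<Sum>x\<in>B. green x) = 1"
proof -
  have "(\<Sum>x\<in>B. occupation x l) = survival l - survival (Suc l)" for l
    unfolding survival_Suc survival_eq_sum[of l]
    using sum.subset_diff[OF B_subset finite_V, of "\<lambda>x. occupation x l"] by simp
  moreover have "(\<Sum>x\<in>B. green x) = (\<Sum>l. \<Sum>x\<in>B. occupation x l)"
    unfolding green_def by (intro suminf_sum[symmetric] summable_occupation)
  moreover have "(\<lambda>l. survival l - survival (Suc l)) sums (survival 0 - 0)"
    by (intro telescope_sums' summable_LIMSEQ_zero summable_survival)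
  moreover have "survival 0 = 1" by (simp add: survival_def prob_space)
  ultimately show ?thesis by (simp add: sums_iff)
qed

section \<open>Probabilities of reactive visits\<close>

lemma reactive_time_measurable [measurable]:
  "Measurable.pred M (\<lambda>\<omega>. reactive_time A B (\<lambda>k. X k \<omega>) l)"
proof -
  \<comment> \<open>Moving the case distinction out of the time index leaves a fixed offset in each
    disjunct.\<close>
  have eq: "reactive_time A B (\<lambda>k. X k \<omega>) l \<longleftrightarrow> (\<forall>i<l. X i \<omega> \<notin> B) \<and>
      ((X l \<omega> \<in> A \<and> (\<exists>k. reaches_within A B k (\<lambda>i. X (Suc l + i) \<omega>))) \<or>
       (X l \<omega> \<notin> A \<and> (\<exists>k. reaches_within A B k (\<lambda>i. X (l + i) \<omega>))))" for \<omega>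
    by (cases "X l \<omega> \<in> A") (simp_all add: reactive_time_def)
  show ?thesis unfolding eq by measurable
qed

text \<open>Past and future factorise. Outside \<open>A\<close> the future starts at
  \<open>l\<close> and contributes \<open>q x\<close>; from a state of \<open>A\<close> it starts at
  \<open>Suc l\<close>, and averaging \<open>q\<close> over the next state contributes
  \<open>escape x\<close>.\<close>

lemma prob_reactive_time:
  assumes "x \<in> V"
  shows "prob {\<omega> \<in> space M. reactive_time A B (\<lambda>k. X k \<omega>) l \<and> X l \<omega> = x}
    = occupation x l * (if x \<in> A then escape x else q x)"
proof (cases "x \<in> A")
  case False
  have eq: "{\<omega> \<in> space M. reactive_time A B (\<lambda>k. X k \<omega>) l \<and> X l \<omega> = x}
    = {\<omega> \<in> space M. ((\<forall>i<l. X i \<omega> \<notin> B) \<and> X l \<omega> = x) \<and> (\<exists>k. reaches_within A B k (\<lambda>i. X (l + i) \<omega>))}"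
    using False by (auto simp: reactive_time_def)
  show ?thesis
    unfolding eq if_not_P[OF False]
    unfolding occupation_def
    by (rule prob_reaches_eventually[OF determined_survival _ q_LIMSEQ[OF assms]]) (simp, measurable)
next
  case True
  let ?H = "\<lambda>\<omega>. (\<forall>i<l. X i \<omega> \<notin> B) \<and> X l \<omega> = x"
  let ?R = "\<lambda>\<omega>. \<exists>k. reaches_within A B k (\<lambda>i. X (Suc l + i) \<omega>)"
  have det: "determined (Suc l) ?H"
    by (intro determined_mono[OF determined_state[OF determined_survival]]) simp_all
  have eq: "{\<omega> \<in> space M. reactive_time A B (\<lambda>k. X k \<omega>) l \<and> X l \<omega> = x} = {\<omega> \<in> space M. ?H \<omega> \<and> ?R \<omega>}"
    using True by (auto simp: reactive_time_def)
  have "prob {\<omega> \<in> space M. ?H \<omega> \<and> ?R \<omega>} = (\<Sum>y\<in>V. prob {\<omega> \<in> space M. (?H \<omega> \<and> ?R \<omega>) \<and> X (Suc l) \<omega> = y})"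
    by (intro prob_finite_partition[where f="X (Suc l)"] finite_V X_in_V) measurable
  also have "\<dots> = (\<Sum>y\<in>V. prob {\<omega> \<in> space M. (?H \<omega> \<and> X (Suc l) \<omega> = y) \<and> ?R \<omega>})"
    by (simp only: conj_ac)
  also have "\<dots> = (\<Sum>y\<in>V. prob {\<omega> \<in> space M. ?H \<omega> \<and> X (Suc l) \<omega> = y} * q y)"
    by (intro sum.cong refl prob_reaches_eventually det q_LIMSEQ) measurable
  also have "\<dots> = (\<Sum>y\<in>V. occupation x l * pmf (p x) y * q y)"
  proof (rule sum.cong[OF refl])
    fix y
    have "prob {\<omega> \<in> space M. (\<forall>i<l. X i \<omega> \<notin> B) \<and> X l \<omega> = x \<and> X (Suc l) \<omega> = y}
        = occupation x l * pmf (p x) y"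
      unfolding occupation_def by (rule prob_step[OF determined_survival]) (simp, measurable)
    then show "prob {\<omega> \<in> space M. ?H \<omega> \<and> X (Suc l) \<omega> = y} * q y = occupation x l * pmf (p x) y * q y"
      by (simp only: conj_assoc)
  qed
  also have "\<dots> = occupation x l * escape x"
    by (simp add: escape_def sum_distrib_left mult.assoc)
  finally show ?thesis unfolding eq if_P[OF True] .
qed

section \<open>Measurability and integration of the visit count\<close>

lemma last_hitting_time_measurable [measurable]:
  "(\<lambda>\<omega>. last_hitting_time A B (\<lambda>k. X k \<omega>)) \<in> measurable M (count_space UNIV)"
  unfolding last_hitting_time_def enat_less_hitting_time by measurable

abbreviation window_visits :: "nat \<Rightarrow> 'w \<Rightarrow> real" where
  "window_visits x \<omega> \<equiv>
     (\<Sum>l | last_hitting_time A B (\<lambda>k. X k \<omega>) \<le> l \<and> enat l \<le> hitting_time B (\<lambda>k. X k \<omega>).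
        indicator {x} (X l \<omega>))"

text \<open>
  The integrand of \<^const>\<open>reactive_visits\<close> must be measurable everywhere, also on the null set where
  \<open>B\<close> is never hit: a Bochner integral of a non-measurable function is 0.
\<close>

lemma window_visits_eq_suminf:
  "window_visits x \<omega> = (if \<exists>k. X k \<omega> \<in> B then
     (\<Sum>l. if last_hitting_time A B (\<lambda>k. X k \<omega>) \<le> l \<and> (\<forall>k<l. X k \<omega> \<notin> B)
          \<and> X l \<omega> = x then 1 else 0) else 0)"
proof (cases "\<exists>k. X k \<omega> \<in> B")
  case True
  let ?S = "{l. last_hitting_time A B (\<lambda>k. X k \<omega>) \<le> l \<and> enat l \<le> hitting_time B (\<lambda>k. X k \<omega>)}"
  have fin: "finite ?S" using True by (simp only: reactive_window_finite_iff)
  have "(\<Sum>l. if last_hitting_time A B (\<lambda>k. X k \<omega>) \<le> l \<and> (\<forall>k<l. X k \<omega> \<notin> B)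
          \<and> X l \<omega> = x then 1 else 0)
    = (\<Sum>l\<in>?S. if last_hitting_time A B (\<lambda>k. X k \<omega>) \<le> l \<and> (\<forall>k<l. X k \<omega> \<notin> B)
          \<and> X l \<omega> = x then 1 else (0::real))"
    using fin by (rule suminf_finite) (auto simp: enat_le_hitting_time)
  also have "\<dots> = window_visits x \<omega>"
    by (rule sum.cong) (auto simp: enat_le_hitting_time indicator_def)
  finally show ?thesis using True by simp
next
  case False
  \<comment> \<open>A sum over an infinite set is 0 by default, which agrees with the else
    branch.\<close>
  then have "infinite {l. last_hitting_time A B (\<lambda>k. X k \<omega>) \<le> l \<and> enat l \<le> hitting_time B (\<lambda>k. X k \<omega>)}"
    by (simp only: reactive_window_finite_iff not_False_eq_True)
  then show ?thesis using False by simp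
qed

lemma window_visits_measurable [measurable]: "window_visits x \<in> borel_measurable M"
  unfolding window_visits_eq_suminf by measurable

text \<open>The count is almost surely a series of indicators of reactive visits, one for each time;
  integrating term by term leaves \<open>occupation\<close> times a factor independent of
  \<open>l\<close>.\<close>

lemma reactive_visits_eq_green:
  assumes "x \<in> V"
  shows "reactive_visits A B M X x = green x * (if x \<in> A then escape x else q x)"
proof -
  define D where "D l = {\<omega> \<in> space M. reactive_time A B (\<lambda>k. X k \<omega>) l \<and> X l \<omega> = x}" for l
  have D_meas [measurable]: "D l \<in> events" for l unfolding D_def by measurable
  have prob_D: "prob (D l) = occupation x l * (if x \<in> A then escape x else q x)" for l
    unfolding D_def using assms by (rule prob_reactive_time)
  \<comment> \<open>This holds only almost surely, since identifying the reactive times takes a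
    start in \<open>A\<close> and a hit of \<open>B\<close>.\<close>
  have path: "AE \<omega> in M. (\<lambda>l. indicator (D l) \<omega> :: real) sums window_visits x \<omega>"
    using AE_start AE_hits_B AE_space
  proof eventually_elim
    case (elim \<omega>)
    let ?S = "{l. last_hitting_time A B (\<lambda>k. X k \<omega>) \<le> l \<and> enat l \<le> hitting_time B (\<lambda>k. X k \<omega>)}"
    note iff = reactive_time_iff[OF disjoint elim(1,2)]
    have fin: "finite ?S" using elim(2) by (simp only: reactive_window_finite_iff)
    have "(\<lambda>l. indicator (D l) \<omega> :: real) sums (\<Sum>l\<in>?S. indicator (D l) \<omega>)"
      using fin by (rule sums_finite) (auto simp: D_def iff)
    also have "(\<Sum>l\<in>?S. indicator (D l) \<omega> :: real) = window_visits x \<omega>"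
      using elim(3) by (intro sum.cong refl) (auto simp: D_def iff indicator_def)
    finally show ?case .
  qed
  have "reactive_visits A B M X x = (\<integral>\<omega>. (\<Sum>l. indicator (D l) \<omega>) \<partial>M)"
    unfolding reactive_visits_def
    using path by (intro integral_cong_AE) (auto simp: sums_iff)
  also have "\<dots> = (\<Sum>l. \<integral>\<omega>. indicator (D l) \<omega> \<partial>M)"
  proof (rule integral_suminf)
    show "AE \<omega> in M. summable (\<lambda>l. norm (indicator (D l) \<omega> :: real))"
      using path by eventually_elim (simp add: sums_iff)
    show "summable (\<lambda>l. \<integral>\<omega>. norm (indicator (D l) \<omega> :: real) \<partial>M)"
      using summable_mult2[OF summable_occupation] by (simp add: prob_D)
    show "integrable M (indicator (D l) :: _ \<Rightarrow> real)" for l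
      by (rule integrable_real_indicator[OF D_meas]) (simp add: less_top[symmetric])
  qed
  also have "\<dots> = (\<Sum>l. occupation x l * (if x \<in> A then escape x else q x))"
    by (simp add: prob_D)
  also have "\<dots> = green x * (if x \<in> A then escape x else q x)"
    unfolding green_def by (rule suminf_mult2[OF summable_occupation, symmetric])
  finally show ?thesis .
qed

lemma reactive_visits_A:
  assumes "x \<in> A"
  shows "reactive_visits A B M X x = reactive_entrance A B M X x"
  unfolding reactive_visits_def reactive_entrance_def
proof (rule integral_cong_AE)
  \<comment> \<open>The time index is itself random; measurability follows by splitting over its
    countably many values.\<close>
  have "(\<lambda>\<omega>. X (last_hitting_time A B (\<lambda>k. X k \<omega>)) \<omega>) \<in> measurable M (count_space UNIV)"
    by (rule measurable_compose_countable[where f="X"]) measurable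
  from measurable_compose[OF this, of "indicator {x}" borel]
  show "(\<lambda>\<omega>. indicator {x} (X (last_hitting_time A B (\<lambda>k. X k \<omega>)) \<omega>) :: real) \<in> borel_measurable M"
    by simp
  show "AE \<omega> in M. window_visits x \<omega> = indicator {x} (X (last_hitting_time A B (\<lambda>k. X k \<omega>)) \<omega>)"
    using AE_start AE_hits_B
    by eventually_elim (rule sum_reactive_window_entrance[OF disjoint _ _ assms])
qed measurable

text \<open>This is the Green equation multiplied by \<open>q x\<close>, with \<open>green y\<close>
  rewritten through the visits to \<open>y\<close>; the weight in these visits cancels the
  denominator of the kernel.\<close>

lemma reactive_visits_equation:
  assumes x: "x \<in> V - A"
  shows "reactive_visits A B M X x =
    (\<Sum>y\<in>reactive_states V p B q. reactive_visits A B M X y * reactive_kernel V p A q y x)"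
proof -
  have "reactive_visits A B M X x = (\<Sum>y\<in>V - B. green y * pmf (p y) x * q x)"
    using x by (simp add: reactive_visits_eq_green green_equation[OF x] sum_distrib_right)
  also have "\<dots> = (\<Sum>y\<in>reactive_states V p B q.
      reactive_visits A B M X y * reactive_kernel V p A q y x)"
  proof (rule sum.mono_neutral_cong_right)
    show "finite (V - B)" using finite_V by simp
    show "reactive_states V p B q \<subseteq> V - B" by (auto simp: reactive_states_def)
    show "\<forall>y\<in>(V - B) - reactive_states V p B q. green y * pmf (p y) x * q x = 0"
    proof
      fix y assume "y \<in> (V - B) - reactive_states V p B q"
      then have "\<not> escape y > 0"
        unfolding reactive_states_def escape_def by blast
      then have "escape y = 0" using escape_nonneg[of y] by linarith
      \<comment> \<open>\<open>escape y\<close> is a sum of nonnegative terms, so its vanishing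
        kills each of them, including the one for \<open>x\<close>.\<close>
      then have "pmf (p y) x * q x = 0"
        unfolding escape_def using x finite_V q_nonneg by (subst (asm) sum_nonneg_eq_0_iff) auto
      then show "green y * pmf (p y) x * q x = 0" by auto
    qed
    fix y assume "y \<in> reactive_states V p B q"
    then have y: "y \<in> V" "y \<notin> B" "escape y > 0"
      by (auto simp: reactive_states_def escape_def)
    \<comment> \<open>On \<open>A\<close> the weight is \<open>escape y\<close>, the denominator of
      the kernel; elsewhere it is \<open>q y\<close>, which equals \<open>escape y\<close> by
      harmonicity. Both are nonzero here.\<close>
    show "green y * pmf (p y) x * q x = reactive_visits A B M X y * reactive_kernel V p A q y x"
      using y q_harmonic[OF y(1) _ y(2)]
      by (simp add: reactive_visits_eq_green reactive_kernel_def flip: escape_def)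
  qed
  finally show ?thesis .
qed

lemma sum_reactive_visits_B: "(\<Sum>x\<in>B. reactive_visits A B M X x) = 1"
proof -
  have "reactive_visits A B M X x = green x" if "x \<in> B" for x
  proof -
    have "x \<in> V" "x \<notin> A" using that B_subset disjoint by auto
    then show ?thesis using q_B[OF that] by (simp add: reactive_visits_eq_green)
  qed
  then show ?thesis using sum_green_B by simp
qed

end

theorem proposition6:
  fixes n :: nat and V A B :: "nat set"
    and p :: "nat \<Rightarrow> nat pmf" and \<mu> :: "nat pmf"
    and M :: "'w measure" and X :: "nat \<Rightarrow> 'w \<Rightarrow> nat"
    and Q :: "nat \<Rightarrow> 'v measure" and Y :: "nat \<Rightarrow> 'v \<Rightarrow> nat"
    and q \<theta> :: "nat \<Rightarrow> real"
  assumes "n > 1" and "V = {1..n}"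
    and "\<forall>x\<in>V. set_pmf (p x) \<subseteq> V"
    and "A \<subseteq> V" and "B \<subseteq> V" and "A \<inter> B = {}" and "A \<noteq> {}" and "B \<noteq> {}"
    and "V - (A \<union> B) \<noteq> {}"
    and "\<forall>x\<in>V - (A \<union> B). reachable V p A B A x \<or> reachable V p A B B x"
    and "\<forall>x\<in>A. reachable V p A B B x"
    and "set_pmf \<mu> \<subseteq> A"
    and "markov_chain V p \<mu> M X"
    and "\<forall>x\<in>V. markov_chain V p (return_pmf x) (Q x) Y"
    and "q = committor A B Q Y"
    and "\<theta> = reactive_visits A B M X"
  shows "(\<forall>x\<in>A. \<theta> x = reactive_entrance A B M X x) \<and>
         (\<forall>x\<in>V - A. \<theta> x = (\<Sum>y\<in>reactive_states V p B q. \<theta> y * reactive_kernel V p A q y x)) \<and>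
         (\<Sum>x\<in>B. \<theta> x) = 1"
proof -
  have fin: "finite V" using assms(2) by simp
  have B_pos: "\<exists>k. hit_prob V p {} B k x > 0" if "x \<in> B" for x
    using that by (intro exI[of _ 0]) simp
  have A_pos: "\<exists>k. hit_prob V p {} B k x > 0" if "x \<in> A" for x
    using assms(11) that by (intro reachable_hit_prob_pos[OF fin _ B_pos]) auto
  \<comment> \<open>Off \<open>A\<close> and \<open>B\<close>, a path to \<open>A\<close> is
    prolonged by one from \<open>A\<close> to \<open>B\<close>, so positivity extends to all of
    \<open>V\<close>.\<close>
  have pos: "\<exists>k. hit_prob V p {} B k x > 0" if "x \<in> V" for x
  proof (cases "x \<in> A \<union> B")
    case True
    then show ?thesis using A_pos B_pos by blast
  next
    case False
    then have "reachable V p A B A x \<or> reachable V p A B B x" using assms(10) that by blast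
    then show ?thesis
      using reachable_hit_prob_pos[OF fin _ A_pos] reachable_hit_prob_pos[OF fin _ B_pos] by metis
  qed
  interpret finite_markov_chain M V p \<mu> X
    using fin assms(13) by (rule finite_markov_chainI)
  interpret transition_path M V p \<mu> X A B q
  proof
    show "(\<lambda>k. hit_prob V p A B k x) \<longlonglongrightarrow> q x" if "x \<in> V" for x
      unfolding assms(15) using fin assms(14) that by (intro hit_prob_LIMSEQ_committor) auto
  qed (rule assms(5) assms(6) assms(12) pos | assumption)+
  show ?thesis
    unfolding assms(16)
    by (intro conjI ballI reactive_visits_A reactive_visits_equation sum_reactive_visits_B)
qed

end
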